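(* Let $E=(x_1,\dots,x_n)$ be an $n$-tuple of collinear points in $\mathbb{R}^2$ with pairwise commensurable distances. Then $E$ has the weighted discrete Pompeiu property with respect to the rigid motions of the plane.
   Context: Let $\mathcal{G}$ be a family of bijections of a set $X$ onto itself. An $n$-tuple $(x_1,\dots,x_n)$ of points of $X$ has the weighted discrete Pompeiu property with respect to $\mathcal{G}$ if the following holds: whenever $\alpha_1,\dots,\alpha_n$ are complex numbers with $\sum_{i=1}^n\alpha_i\neq 0$ and $f\colon X\to\mathbb{C}$ is a function (no regularity assumed) such that $\sum_{j=1}^n\alpha_j f(\phi(x_j))=0$ for every $\phi\in\mathcal{G}$, then $f\equiv 0$. A rigid motion of the plane is an orientation-preserving isometry of $\mathbb{R}^2$, i.e. a translation or a rotation. The points have pairwise commensurable distances if there is a real $d>0$ such that every distance $|x_i-x_j|$ is a rational multiple of $d$. *)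

theory Defs
  imports "HOL-Analysis.Analysis"
begin

text \<open>
  An \<open>n\<close>-tuple is a function on \<open>nat\<close> of which only the values at \<open>1, \<dots>, n\<close> matter; repeated
  points are allowed. The ambient set is the whole type \<open>'a\<close>, and \<open>G\<close> is meant to be a family of
  bijections of it.
\<close>

definition weighted_discrete_Pompeiu :: "('a \<Rightarrow> 'a) set \<Rightarrow> nat \<Rightarrow> (nat \<Rightarrow> 'a) \<Rightarrow> bool" where
  "weighted_discrete_Pompeiu G n x \<longleftrightarrow>
     (\<forall>(\<alpha> :: nat \<Rightarrow> complex) (f :: 'a \<Rightarrow> complex).
        (\<Sum>i=1..n. \<alpha> i) \<noteq> 0 \<longrightarrow>
        (\<forall>\<phi>\<in>G. (\<Sum>j=1..n. \<alpha> j * f (\<phi> (x j))) = 0) \<longrightarrow>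
        (\<forall>p. f p = 0))"

text \<open>
  An isometry \<open>\<phi>\<close> of the plane is affine, with linear part \<open>\<lambda>p. \<phi> p - \<phi> 0\<close>; it preserves the
  orientation iff the determinant of that linear part is positive.
\<close>

definition rigid_motions :: "(real^2 \<Rightarrow> real^2) set" where
  "rigid_motions =
     {\<phi>. (\<forall>p q. dist (\<phi> p) (\<phi> q) = dist p q) \<and> det (matrix (\<lambda>p. \<phi> p - \<phi> 0)) > 0}"

definition commensurable_distances :: "nat \<Rightarrow> (nat \<Rightarrow> 'a::metric_space) \<Rightarrow> bool" where
  "commensurable_distances n x \<longleftrightarrow>
     (\<exists>d::real. d > 0 \<and> (\<forall>i\<in>{1..n}. \<forall>j\<in>{1..n}. \<exists>r\<in>\<rat>. dist (x i) (x j) = r * d))"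

lemma rigid_motions_iff_affine:
  "\<phi> \<in> rigid_motions \<longleftrightarrow> (\<exists>Q b. rotation_matrix Q \<and> \<phi> = (\<lambda>p. Q *v p + b))"
proof
  assume a: "\<phi> \<in> rigid_motions"
  define g where "g = (\<lambda>p. \<phi> p - \<phi> 0)"
  have "g 0 = 0" "\<forall>p q. dist (g p) (g q) = dist p q" and d: "det (matrix g) > 0"
    using a by (auto simp: rigid_motions_def g_def dist_norm)
  then have o: "orthogonal_transformation g"
    by (simp add: orthogonal_transformation_isometry)
  then have om: "orthogonal_matrix (matrix g)" and "linear g"
    by (auto simp: orthogonal_transformation_matrix)
  then have "rotation_matrix (matrix g)"
    using d det_orthogonal_matrix[OF om] by (auto simp: rotation_matrix_def)
  moreover have "\<phi> = (\<lambda>p. matrix g *v p + \<phi> 0)"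
    using \<open>linear g\<close> by (auto simp: matrix_works g_def)
  ultimately show "\<exists>Q b. rotation_matrix Q \<and> \<phi> = (\<lambda>p. Q *v p + b)" by blast
next
  assume "\<exists>Q b. rotation_matrix Q \<and> \<phi> = (\<lambda>p. Q *v p + b)"
  then obtain Q b where Q: "rotation_matrix Q" and phi: "\<phi> = (\<lambda>p. Q *v p + b)" by blast
  then have "orthogonal_transformation ((*v) Q)"
    by (simp add: orthogonal_transformation_matrix rotation_matrix_def)
  then have "dist (Q *v p) (Q *v q) = dist p q" for p q
    by (simp add: orthogonal_transformation_isometry)
  then show "\<phi> \<in> rigid_motions"
    using Q by (simp add: rigid_motions_def phi rotation_matrix_def)
qed

lemma rigid_motions_iff_translation_or_rotation:
  "\<phi> \<in> rigid_motions \<longleftrightarrow>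
     (\<exists>b. \<phi> = (\<lambda>p. p + b)) \<or> (\<exists>Q c. rotation_matrix Q \<and> \<phi> = (\<lambda>p. c + Q *v (p - c)))"
proof
  assume "\<phi> \<in> rigid_motions"
  then obtain Q :: "real^2^2" and b where Q: "rotation_matrix Q" and phi: "\<phi> = (\<lambda>p. Q *v p + b)"
    by (auto simp: rigid_motions_iff_affine)
  show "(\<exists>b. \<phi> = (\<lambda>p. p + b)) \<or> (\<exists>Q c. rotation_matrix Q \<and> \<phi> = (\<lambda>p. c + Q *v (p - c)))"
  proof (cases "Q = mat 1")
    case True
    then show ?thesis by (auto simp: phi)
  next
    case False
    have "Q ** transpose Q = mat 1" "transpose Q ** Q = mat 1" and dQ: "det Q = 1"
      using Q by (auto simp: rotation_matrix_def orthogonal_matrix_def)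
    then have e: "Q$1$1 * Q$1$1 + Q$1$2 * Q$1$2 = 1" "Q$1$1 * Q$1$1 + Q$2$1 * Q$2$1 = 1"
                 "Q$2$2 * Q$2$2 + Q$1$2 * Q$1$2 = 1"
      and d: "Q$1$1 * Q$2$2 - Q$1$2 * Q$2$1 = 1"
      by (auto simp: vec_eq_iff matrix_matrix_mult_def transpose_def mat_def forall_2 sum_2 det_2)
    have "(Q$1$1 - Q$2$2)^2 + (Q$1$2 + Q$2$1)^2 = 0"
      using e d by (simp add: power2_eq_square algebra_simps)
    then have s: "Q$2$2 = Q$1$1" "Q$2$1 = - Q$1$2"
      by (auto simp: sum_power2_eq_zero_iff)
    have ne: "Q$1$1 \<noteq> 1"
    proof
      assume "Q$1$1 = 1"
      with e s have "Q = mat 1" by (auto simp: vec_eq_iff forall_2 mat_def)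
      with False show False by simp
    qed
    have "det (mat 1 - Q) = 2 * (1 - Q$1$1)"
      using e s by (simp add: det_2 mat_def algebra_simps)
    with ne have inv: "invertible (mat 1 - Q)"
      by (simp add: invertible_det_nz)
    then obtain c where "(mat 1 - Q) *v c = b"
      by (metis invertible_def matrix_vector_mul_assoc matrix_vector_mul_lid)
    then have "b = c - Q *v c"
      by (simp add: matrix_vector_mult_diff_rdistrib)
    then have "\<phi> = (\<lambda>p. c + Q *v (p - c))"
      by (auto simp: phi matrix_vector_mult_diff_distrib)
    with Q show ?thesis by blast
  qed
next
  have id: "rotation_matrix (mat 1 :: real^2^2)"
    by (simp add: rotation_matrix_def orthogonal_matrix_id)
  have rot: "(\<lambda>p. c + Q *v (p - c)) = (\<lambda>p. Q *v p + (c - Q *v c))" for Q :: "real^2^2" and c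
    by (auto simp: matrix_vector_mult_diff_distrib)
  have tr: "(\<lambda>p. p + b) = (\<lambda>p. mat 1 *v p + b)" for b :: "real^2"
    by simp
  assume "(\<exists>b. \<phi> = (\<lambda>p. p + b)) \<or> (\<exists>Q c. rotation_matrix Q \<and> \<phi> = (\<lambda>p. c + Q *v (p - c)))"
  then show "\<phi> \<in> rigid_motions"
    unfolding rigid_motions_iff_affine using id rot tr by metis
qed

lemma bij_rigid_motion:
  assumes "\<phi> \<in> rigid_motions"
  shows "bij \<phi>"
proof -
  obtain Q b where Q: "rotation_matrix Q" and phi: "\<phi> = (\<lambda>p. Q *v p + b)"
    using assms by (auto simp: rigid_motions_iff_affine)
  then have "bij ((*v) Q)"
    by (simp add: orthogonal_transformation_bij orthogonal_transformation_matrix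
        rotation_matrix_def)
  then have "bij ((\<lambda>y. y + b) \<circ> ((*v) Q))"
    by (intro bij_comp) (auto simp: bij_plus_right)
  then show ?thesis by (simp add: phi o_def)
qed

end

theory Submission
  imports Defs "HOL-Computational_Algebra.Fundamental_Theorem_Algebra"
begin

text \<open>
  Commensurability puts the points on an arithmetic progression, \<open>x\<^sub>j = q + k\<^sub>j w\<close> with natural
  numbers \<open>k\<^sub>j\<close>. Let \<open>T\<^sub>v\<close> be the translation operator \<open>f \<mapsto> f(\<cdot> + v)\<close> and
  \<open>P(z) = \<Sum>\<^sub>j \<alpha>\<^sub>j z^k\<^sub>j\<close>. Since the rigid motions take \<open>(q, w)\<close> to every pair \<open>(p, v)\<close> with
  \<open>|v| = |w|\<close>, the hypothesis on \<open>f\<close> says that \<open>P(T\<^sub>v) f = 0\<close> for all vectors \<open>v\<close> of length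
  \<open>s = |w|\<close>, and the condition on the weights says that \<open>P(1) \<noteq> 0\<close>.

  Suppose \<open>f \<noteq> 0\<close>. Translations commute, so the space of functions annihilated by all these
  \<open>P(T\<^sub>v)\<close> is invariant under translations. As \<open>P(T\<^sub>v)\<close> vanishes on it, applying a suitable polynomial
  in \<open>T\<^sub>v\<close> to a nonzero member gives a nonzero eigenfunction of \<open>T\<^sub>v\<close>, whose eigenvalue is a root
  of \<open>P\<close>. Eigenfunctions for earlier vectors stay eigenfunctions, so any finite set of vectors of
  length \<open>s\<close> has a common eigenfunction \<open>g \<noteq> 0\<close> in the space (\<open>ex_common_eigenfunction\<close>).

  A vector of length at most \<open>2s\<close> is a sum of two vectors of length \<open>s\<close>, so its translation acts
  on a suitable \<open>g\<close> by a product of two roots of \<open>P\<close>. There are only finitely many such products,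
  say \<open>K\<close>. Fix \<open>v\<close> of length \<open>s\<close> and put \<open>L = K!\<close>. Among the \<open>K + 1\<close> vectors \<open>(i/L) v\<close> with
  \<open>0 \<le> i \<le> K\<close> two have the same eigenvalue, so \<open>g\<close> has the period \<open>((j - i)/L) v\<close> for some
  \<open>1 \<le> j - i \<le> K\<close>. Now \<open>j - i\<close> divides \<open>L\<close>, so \<open>v\<close> is a multiple of this period and
  \<open>T\<^sub>v g = g\<close>. Then \<open>0 = P(T\<^sub>v) g = P(1) g\<close>, a contradiction
  (\<open>zero_if_annihilated_by_all_shifts_of_norm\<close>).
\<close>

section \<open>Polynomials acting through a translation\<close>

text \<open>
  This is \<open>P(T\<^sub>v) f\<close> for the translation operator \<open>T\<^sub>v f = f(\<cdot> + v)\<close>, evaluated at \<open>p\<close>.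
\<close>

definition poly_shift :: "complex poly \<Rightarrow> 'a::real_vector \<Rightarrow> ('a \<Rightarrow> complex) \<Rightarrow> 'a \<Rightarrow> complex" where
  "poly_shift P v f p = (\<Sum>i\<le>degree P. coeff P i * f (p + of_nat i *\<^sub>R v))"

lemma poly_shift_altdef:
  assumes "degree P \<le> N"
  shows "poly_shift P v f p = (\<Sum>i\<le>N. coeff P i * f (p + of_nat i *\<^sub>R v))"
  unfolding poly_shift_def
  by (rule sum.mono_neutral_left) (use assms in \<open>auto simp: coeff_eq_0\<close>)

lemma poly_shift_zero [simp]: "poly_shift P v (\<lambda>_. 0) = (\<lambda>_. 0)"
  by (simp add: poly_shift_def fun_eq_iff)

lemma poly_shift_commute:
  "poly_shift P v (poly_shift Q w f) = poly_shift Q w (poly_shift P v f)"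
  unfolding poly_shift_def fun_eq_iff sum_distrib_left
  by (subst sum.swap) (auto intro!: sum.cong simp: algebra_simps)

lemma poly_shift_linear_factor:
  "poly_shift ([:- c, 1:] * Q) v f p = poly_shift Q v f (p + v) - c * poly_shift Q v f p"
proof -
  let ?n = "degree Q"
  have "degree ([:- c, 1:] * Q) \<le> Suc ?n"
    by (rule order_trans[OF degree_mult_le]) auto
  then have "poly_shift ([:- c, 1:] * Q) v f p
      = (\<Sum>i\<le>Suc ?n. coeff (pCons 0 Q) i * f (p + of_nat i *\<^sub>R v))
        - c * (\<Sum>i\<le>Suc ?n. coeff Q i * f (p + of_nat i *\<^sub>R v))"
    by (simp only: poly_shift_altdef sum_distrib_left flip: sum_subtractf)
       (intro sum.cong; simp add: algebra_simps)
  also have "(\<Sum>i\<le>Suc ?n. coeff Q i * f (p + of_nat i *\<^sub>R v)) = poly_shift Q v f p"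
    by (rule poly_shift_altdef[symmetric]) simp
  also have "(\<Sum>i\<le>Suc ?n. coeff (pCons 0 Q) i * f (p + of_nat i *\<^sub>R v)) = poly_shift Q v f (p + v)"
    by (simp add: sum.atMost_Suc_shift poly_shift_def algebra_simps del: sum.atMost_Suc)
  finally show ?thesis .
qed

lemma poly_shift_eigenfunction:
  assumes "\<And>p. f (p + v) = c * f p"
  shows "poly_shift P v f p = poly P c * f p"
proof -
  have "f (p + of_nat i *\<^sub>R v) = c ^ i * f p" for i
  proof (induction i)
    case (Suc i)
    have "f (p + of_nat (Suc i) *\<^sub>R v) = f ((p + of_nat i *\<^sub>R v) + v)"
      by (simp add: algebra_simps)
    with Suc show ?case by (simp add: assms)
  qed simp
  then show ?thesis
    by (simp add: poly_shift_def poly_altdef sum_distrib_left mult_ac)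
qed

lemma poly_shift_preserves_eigenfunction:
  assumes "\<And>p. f (p + w) = c * f p"
  shows "poly_shift P v f (p + w) = c * poly_shift P v f p"
proof -
  have "f (p + w + of_nat i *\<^sub>R v) = c * f (p + of_nat i *\<^sub>R v)" for i
    using assms[of "p + of_nat i *\<^sub>R v"] by (simp add: algebra_simps)
  then show ?thesis
    by (simp add: poly_shift_def sum_distrib_left mult_ac)
qed

lemma poly_shift_sum_monom:
  assumes "finite J"
  shows "poly_shift (\<Sum>j\<in>J. monom (a j) (k j)) v f p = (\<Sum>j\<in>J. a j * f (p + of_nat (k j) *\<^sub>R v))"
proof -
  let ?P = "\<Sum>j\<in>J. monom (a j) (k j)"
  obtain N where N: "degree ?P \<le> N" "\<And>j. j \<in> J \<Longrightarrow> k j \<le> N"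
  proof
    show "degree ?P \<le> degree ?P + sum k J" by simp
    show "k j \<le> degree ?P + sum k J" if "j \<in> J" for j
      using member_le_sum[of j J k] that assms by simp
  qed
  have "poly_shift ?P v f p
      = (\<Sum>i\<le>N. \<Sum>j\<in>J. (if k j = i then a j * f (p + of_nat i *\<^sub>R v) else 0))"
    by (subst poly_shift_altdef[OF N(1)])
       (auto simp: coeff_sum sum_distrib_right intro!: sum.cong)
  also have "\<dots> = (\<Sum>j\<in>J. \<Sum>i\<le>N. (if k j = i then a j * f (p + of_nat i *\<^sub>R v) else 0))"
    by (rule sum.swap)
  also have "\<dots> = (\<Sum>j\<in>J. a j * f (p + of_nat (k j) *\<^sub>R v))"
    by (intro sum.cong) (auto simp: N(2))
  finally show ?thesis .
qed

section \<open>Common eigenfunctions of finitely many translations\<close>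

text \<open>
  Linear factors are removed from the annihilating polynomial \<open>P\<close> one by one. The last function
  before the product reaches zero is killed by a single factor \<open>T\<^sub>v - c\<close>. Having the eigenfunction
  in the form \<open>Q(T\<^sub>v) f\<close> matters: in this form it inherits every property of \<open>f\<close> that commutes with
  translations.
\<close>

lemma ex_eigenfunction:
  assumes "P \<noteq> 0" and "f \<noteq> (\<lambda>_. 0)" and "poly_shift P v f = (\<lambda>_. 0)"
  obtains Q c where "poly_shift Q v f \<noteq> (\<lambda>_. 0)"
    and "\<And>p. poly_shift Q v f (p + v) = c * poly_shift Q v f p"
proof -
  have "\<exists>Q c. poly_shift Q v f \<noteq> (\<lambda>_. 0) \<and> (\<forall>p. poly_shift Q v f (p + v) = c * poly_shift Q v f p)"
    using assms(1,3)
  proof (induction "degree P" arbitrary: P rule: less_induct)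
    case less
    have "degree P \<noteq> 0"
    proof
      assume "degree P = 0"
      then obtain a where "P = [:a:]" by (rule degree_eq_zeroE)
      with less.prems assms(2) show False
        by (auto simp: poly_shift_def fun_eq_iff)
    qed
    then obtain c where "poly P c = 0"
      using fundamental_theorem_of_algebra constant_degree by metis
    then obtain R where P: "P = [:- c, 1:] * R"
      by (auto simp: poly_eq_0_iff_dvd)
    with less.prems(1) have "R \<noteq> 0" by auto
    then have deg: "degree R < degree P"
      unfolding P by (subst degree_mult_eq) auto
    have "poly_shift R v f (p + v) = c * poly_shift R v f p" for p
      using poly_shift_linear_factor[of c R v f p] less.prems(2) by (simp add: P)
    with less.hyps[OF deg \<open>R \<noteq> 0\<close>] show ?case by blast
  qed
  with that show ?thesis by blast
qed

text \<open>
  The eigenfunction for a new vector is \<open>Q(T\<^sub>w) g\<close> with \<open>g\<close> from the previous vectors, and \<open>Q(T\<^sub>w)\<close>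
  commutes with all translations, so neither the annihilation by \<open>P\<close> over the whole of \<open>A\<close> nor the
  earlier eigenvalue equations are lost.
\<close>

lemma ex_common_eigenfunction:
  assumes "finite S" and "S \<subseteq> A" and "P \<noteq> 0"
    and "f \<noteq> (\<lambda>_. 0)" and "\<And>v. v \<in> A \<Longrightarrow> poly_shift P v f = (\<lambda>_. 0)"
  obtains g where "g \<noteq> (\<lambda>_. 0)" and "\<And>v. v \<in> A \<Longrightarrow> poly_shift P v g = (\<lambda>_. 0)"
    and "\<And>v. v \<in> S \<Longrightarrow> \<exists>c. poly P c = 0 \<and> (\<forall>p. g (p + v) = c * g p)"
proof -
  have "\<exists>g. g \<noteq> (\<lambda>_. 0) \<and> (\<forall>v\<in>A. poly_shift P v g = (\<lambda>_. 0)) \<and>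
          (\<forall>v\<in>S. \<exists>c. poly P c = 0 \<and> (\<forall>p. g (p + v) = c * g p))"
    using assms(1,2)
  proof (induction S)
    case empty
    with assms(4,5) show ?case by blast
  next
    case (insert w S)
    then have "S \<subseteq> A" by simp
    from insert.IH[OF this] obtain g where "g \<noteq> (\<lambda>_. 0) \<and> (\<forall>v\<in>A. poly_shift P v g = (\<lambda>_. 0)) \<and>
        (\<forall>v\<in>S. \<exists>c. poly P c = 0 \<and> (\<forall>p. g (p + v) = c * g p))" ..
    then have g: "g \<noteq> (\<lambda>_. 0)" "\<And>v. v \<in> A \<Longrightarrow> poly_shift P v g = (\<lambda>_. 0)"
      "\<And>v. v \<in> S \<Longrightarrow> \<exists>c. poly P c = 0 \<and> (\<forall>p. g (p + v) = c * g p)"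
      by simp_all
    have "w \<in> A" using insert.prems by simp
    obtain Q c where Q: "poly_shift Q w g \<noteq> (\<lambda>_. 0)"
      "\<And>p. poly_shift Q w g (p + w) = c * poly_shift Q w g p"
      using ex_eigenfunction[OF assms(3) g(1) g(2)[OF \<open>w \<in> A\<close>]] by metis
    have ann: "poly_shift P v (poly_shift Q w g) = (\<lambda>_. 0)" if "v \<in> A" for v
      by (subst poly_shift_commute) (simp add: g(2)[OF that])
    obtain q where q: "poly_shift Q w g q \<noteq> 0"
      using Q(1) by (auto simp: fun_eq_iff)
    have "poly P c * poly_shift Q w g q = 0"
      using poly_shift_eigenfunction[of "poly_shift Q w g" w c P q, OF Q(2)] ann[OF \<open>w \<in> A\<close>]
      by simp
    with q have "poly P c = 0" by simp
    moreover have "\<exists>c. poly P c = 0 \<and> (\<forall>p. poly_shift Q w g (p + v) = c * poly_shift Q w g p)"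
      if "v \<in> S" for v
      using g(3)[OF that] poly_shift_preserves_eigenfunction by blast
    ultimately show ?case
      using Q ann by (intro exI[of _ "poly_shift Q w g"] conjI ballI) (auto simp only: insert_iff)
  qed
  with that show ?thesis by blast
qed

section \<open>A polynomial in every translation of a given length\<close>

text \<open>
  The two summands are the sides of a rhombus with diagonal \<open>w\<close>; dimension at least two gives room
  for the other diagonal.
\<close>

lemma ex_sum_of_equal_norms:
  fixes w :: "'a::euclidean_space"
  assumes "2 \<le> DIM('a)" and "norm w \<le> 2 * s"
  obtains a b where "norm a = s" "norm b = s" "a + b = w"
proof -
  obtain y :: 'a where y: "y \<noteq> 0" "orthogonal w y"
    using orthogonal_to_vector_exists[OF assms(1)] .
  (* h y is half of the other diagonal; its length comes from Pythagoras *)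
  define h where "h = sqrt (s\<^sup>2 - (norm w / 2)\<^sup>2) / norm y"
  have "0 \<le> s" using assms(2) norm_ge_zero[of w] by linarith
  have "(norm w / 2)\<^sup>2 \<le> s\<^sup>2"
    using assms(2) by (intro power_mono) auto
  then have h: "(h * norm y)\<^sup>2 = s\<^sup>2 - (norm w / 2)\<^sup>2"
    using y by (simp add: h_def)
  have n: "norm ((1/2) *\<^sub>R w + t *\<^sub>R y) = s" if "t = h \<or> t = - h" for t
  proof -
    have "orthogonal ((1/2) *\<^sub>R w) (t *\<^sub>R y)"
      using y(2) by (simp add: orthogonal_def)
    then have "(norm ((1/2) *\<^sub>R w + t *\<^sub>R y))\<^sup>2 = (norm w / 2)\<^sup>2 + (h * norm y)\<^sup>2"
      using that by (auto simp: norm_add_Pythagorean power_mult_distrib power_divide)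
    with h \<open>0 \<le> s\<close> show ?thesis
      by (simp add: power2_eq_iff_nonneg)
  qed
  show thesis
    by (rule that[of "(1/2) *\<^sub>R w + h *\<^sub>R y" "(1/2) *\<^sub>R w + (- h) *\<^sub>R y"])
       (use n[of h] n[of "- h"] in \<open>auto simp flip: scaleR_add_left\<close>)
qed

text \<open>
  A line meets the sphere of radius \<open>s\<close> in at most two points, but the sums of two vectors of norm
  \<open>s\<close> fill the ball of radius \<open>2s\<close>. So on arbitrarily fine subdivisions of a segment the eigenvalues
  range over one fixed finite set \<open>F\<close>, which forces a period commensurable with \<open>v\<close>.
\<close>

lemma zero_if_annihilated_by_all_shifts_of_norm:
  fixes f :: "'a::euclidean_space \<Rightarrow> complex"
  assumes "2 \<le> DIM('a)" and "0 \<le> s" and "poly P 1 \<noteq> 0"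
    and f: "\<And>v. norm v = s \<Longrightarrow> poly_shift P v f = (\<lambda>_. 0)"
  shows "f = (\<lambda>_. 0)"
proof (rule ccontr)
  assume "f \<noteq> (\<lambda>_. 0)"
  have "P \<noteq> 0" using assms(3) by auto
  define F where "F = (\<lambda>(c, d). c * d) ` ({c. poly P c = 0} \<times> {c. poly P c = 0})"
  have "finite F"
    unfolding F_def using poly_roots_finite[OF \<open>P \<noteq> 0\<close>] by blast
  define K where "K = card F"
  (* a factorial, so that every difference of two indices up to K divides it *)
  define L :: nat where "L = fact K"
  have "L > 0" by (simp add: L_def)
  obtain v :: 'a where v: "norm v = s"
    using vector_choose_size[OF assms(2)] by blast
  define u where "u i = (of_nat i / of_nat L) *\<^sub>R v" for i :: nat
  have "norm (u i) \<le> 2 * s" if "i \<le> K" for i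
  proof -
    have "i \<le> L"
      using that fact_ge_self[of K] by (simp add: L_def)
    then have "of_nat i / of_nat L \<le> (1::real)"
      using \<open>L > 0\<close> by simp
    then have "of_nat i / of_nat L * s \<le> 1 * s"
      using assms(2) by (intro mult_right_mono)
    with assms(2) show ?thesis by (simp add: u_def v)
  qed
  then have "\<exists>a b. norm a = s \<and> norm b = s \<and> a + b = u i" if "i \<le> K" for i
    using ex_sum_of_equal_norms[OF assms(1)] that by metis
  then obtain a b where ab: "\<And>i. i \<le> K \<Longrightarrow> norm (a i) = s \<and> norm (b i) = s \<and> a i + b i = u i"
    by metis
  obtain g where g: "g \<noteq> (\<lambda>_. 0)" "\<And>w. norm w = s \<Longrightarrow> poly_shift P w g = (\<lambda>_. 0)"
    "\<And>w. w \<in> a ` {..K} \<union> b ` {..K} \<Longrightarrow> \<exists>c. poly P c = 0 \<and> (\<forall>p. g (p + w) = c * g p)"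
    using ex_common_eigenfunction[of "a ` {..K} \<union> b ` {..K}" "{w. norm w = s}" P f]
      ab \<open>P \<noteq> 0\<close> \<open>f \<noteq> (\<lambda>_. 0)\<close> f by (auto simp: image_subset_iff)
  have "\<exists>m\<in>F. \<forall>p. g (p + u i) = m * g p" if i: "i \<le> K" for i
  proof -
    obtain c d where "poly P c = 0" "\<forall>p. g (p + a i) = c * g p"
      "poly P d = 0" "\<forall>p. g (p + b i) = d * g p"
      using g(3)[of "a i", OF UnI1] g(3)[of "b i", OF UnI2] i by blast
    moreover from this have "g (p + u i) = d * c * g p" for p
      using ab[OF that] by (metis add.assoc mult.assoc)
    ultimately show ?thesis
      unfolding F_def by (intro bexI[of _ "d * c"]) auto
  qed
  then obtain m where m: "\<And>i. i \<le> K \<Longrightarrow> m i \<in> F \<and> (\<forall>p. g (p + u i) = m i * g p)"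
    by metis
  have "m ` {..K} \<subseteq> F" using m by auto
  then have "card (m ` {..K}) \<le> K"
    using card_mono[OF \<open>finite F\<close>] by (simp add: K_def)
  then have "\<not> inj_on m {..K}"
    by (intro pigeonhole) simp
  then obtain i j where ij: "i < j" "j \<le> K" "m i = m j"
    unfolding inj_on_def by (metis atMost_iff linorder_neqE_nat)
  have "j - i dvd L"
    unfolding L_def by (rule dvd_fact) (use ij in auto)
  then obtain k where k: "L = (j - i) * k" ..
  define w where "w = (of_nat (j - i) / of_nat L) *\<^sub>R v"
  have "g (p + w) = 1 * g p" for p
  proof -
    have "u j = w + u i"
      using ij(1) by (simp add: u_def w_def of_nat_diff diff_divide_distrib flip: scaleR_add_left)
    then have "g (p + w) = g ((p - u i) + u j)" by simp
    also have "\<dots> = g ((p - u i) + u i)"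
      using m[of i] m[of j] ij by (metis less_imp_le order_trans)
    finally show ?thesis by simp
  qed
  moreover have "of_nat k *\<^sub>R w = v"
  proof -
    have "of_nat k * (of_nat (j - i) / of_nat L) = (1::real)"
      using \<open>L > 0\<close> unfolding k by (simp add: field_simps)
    then show ?thesis by (simp only: w_def scaleR_scaleR scaleR_one)
  qed
  (* k steps of the period w make up v; the polynomial z^k expresses this iteration *)
  ultimately have per: "g (p + v) = 1 * g p" for p
    using poly_shift_eigenfunction[of g w 1 "monom 1 k" p]
      poly_shift_sum_monom[of "{0::nat}" "\<lambda>_. 1" "\<lambda>_. k" w g p] by (simp add: poly_monom)
  have "poly P 1 * g p = 0" for p
    using poly_shift_eigenfunction[of g v 1 P p, OF per] g(2)[OF v] by simp
  with assms(3) g(1) show False by (auto simp: fun_eq_iff)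
qed

section \<open>Commensurable points on a line\<close>

lemma ex_common_denominator:
  fixes r :: "'i \<Rightarrow> real"
  assumes "finite I" and "\<And>i. i \<in> I \<Longrightarrow> r i \<in> \<rat>"
  obtains N :: nat where "N > 0" and "\<And>i. i \<in> I \<Longrightarrow> of_nat N * r i \<in> \<int>"
proof -
  have "\<exists>N::nat. N > 0 \<and> (\<forall>i\<in>I. of_nat N * r i \<in> \<int>)"
    using assms
  proof (induction I)
    case empty
    show ?case by auto
  next
    case (insert i I)
    then obtain N :: nat where N: "N > 0" "\<And>j. j \<in> I \<Longrightarrow> of_nat N * r j \<in> \<int>"
      by blast
    obtain a b where b: "b > 0" and ri: "r i = of_int a / of_int b"
      using insert.prems[of i] by (auto elim: Rats_cases')
    have "of_nat (N * nat b) * r i \<in> \<int>"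
      using b by (simp add: ri)
    moreover have "of_nat (N * nat b) * r j \<in> \<int>" if "j \<in> I" for j
    proof -
      have "of_nat (N * nat b) * r j = of_nat (nat b) * (of_nat N * r j)" by simp
      also have "\<dots> \<in> \<int>" using N(2)[OF that] by (rule Ints_mult[OF Ints_of_nat])
      finally show ?thesis .
    qed
    ultimately show ?case
      using N(1) b by (intro exI[of _ "N * nat b"]) auto
  qed
  with that show ?thesis by blast
qed

text \<open>
  Measured from \<open>x 1\<close>, the signed distances along the line are integer multiples of \<open>d\<close> over a common
  denominator. Moving the origin \<open>q\<close> back beyond all points makes the multiples natural numbers, so
  that a polynomial, and not a Laurent polynomial, describes the configuration.
\<close>

lemma commensurable_collinear_imp_arith_progression:
  fixes x :: "nat \<Rightarrow> 'a::{real_normed_vector, perfect_space}"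
  assumes "collinear (x ` {1..n})" and "commensurable_distances n x"
  obtains q w k where "w \<noteq> 0" and "\<And>i. i \<in> {1..n} \<Longrightarrow> x i = q + of_nat (k i) *\<^sub>R w"
proof -
  obtain u0 where u0: "u0 \<noteq> 0"
    "\<forall>y\<in>x ` {1..n}. \<forall>z\<in>x ` {1..n}. \<exists>c. y - z = c *\<^sub>R u0"
    using assms(1) unfolding collinear by blast
  define u where "u = u0 /\<^sub>R norm u0"
  have nu: "norm u = 1" using u0(1) by (simp add: u_def)
  obtain d where d: "d > 0" "\<And>i j. i \<in> {1..n} \<Longrightarrow> j \<in> {1..n} \<Longrightarrow> \<exists>r\<in>\<rat>. dist (x i) (x j) = r * d"
    using assms(2) unfolding commensurable_distances_def by blast
  have "\<exists>r. r \<in> \<rat> \<and> x i = x 1 + (r * d) *\<^sub>R u" if i: "i \<in> {1..n}" for i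
  proof -
    have 1: "1 \<in> {1..n}" using i by simp
    obtain c where "x i - x 1 = c *\<^sub>R u0"
      using u0(2) i 1 by blast
    then have c: "x i - x 1 = (c * norm u0) *\<^sub>R u"
      using u0(1) by (simp add: u_def)
    obtain r where r: "r \<in> \<rat>" "dist (x i) (x 1) = r * d"
      using d(2)[OF i 1] by blast
    then have "\<bar>c * norm u0\<bar> = r * d"
      unfolding dist_norm c by (simp add: nu)
    then have "c * norm u0 = r * d \<or> c * norm u0 = (- r) * d"
      by linarith
    then obtain r' where "r' \<in> \<rat>" "c * norm u0 = r' * d"
      using r(1) Rats_minus_iff by metis
    with c show ?thesis
      by (intro exI[of _ r']) (simp add: algebra_simps)
  qed
  then obtain r where r: "\<And>i. i \<in> {1..n} \<Longrightarrow> r i \<in> \<rat> \<and> x i = x 1 + (r i * d) *\<^sub>R u"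
    by metis
  obtain N :: nat where N: "N > 0" "\<And>i. i \<in> {1..n} \<Longrightarrow> of_nat N * r i \<in> \<int>"
    using ex_common_denominator[of "{1..n}" r] r by auto
  then have "\<exists>z. of_nat N * r i = of_int z" if "i \<in> {1..n}" for i
    using that by (auto elim: Ints_cases)
  then obtain z :: "nat \<Rightarrow> int" where z: "\<And>i. i \<in> {1..n} \<Longrightarrow> of_nat N * r i = of_int (z i)"
    by metis
  (* a crude bound for the most negative index *)
  define M where "M = (\<Sum>i=1..n. \<bar>z i\<bar>)"
  have M: "- M \<le> z i" if "i \<in> {1..n}" for i
    using member_le_sum[of i "{1..n}" "\<lambda>i. \<bar>z i\<bar>"] that by (auto simp: M_def)
  define w where "w = (d / of_nat N) *\<^sub>R u"
  show thesis
  proof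
    show "w \<noteq> 0" using d(1) N(1) nu by (auto simp: w_def)
    show "x i = (x 1 - of_int M *\<^sub>R w) + of_nat (nat (z i + M)) *\<^sub>R w" if i: "i \<in> {1..n}" for i
    proof -
      have "r i * d = of_int (z i) * (d / of_nat N)"
        using z[OF i] N(1) by (simp add: field_simps)
      then have "x i = x 1 + of_int (z i) *\<^sub>R w"
        using r[OF i] by (simp add: w_def)
      then show ?thesis
        using M[OF i] by (simp add: algebra_simps)
    qed
  qed
qed

text \<open>
  The motion depends only on the line and its direction, hence moves all points
  \<open>q + k\<^sub>j w\<close> of the configuration at once.
\<close>

lemma ex_rigid_motion_mapping_line:
  assumes "norm v = norm w"
  obtains \<phi> where "\<phi> \<in> rigid_motions" and "\<And>t. \<phi> (q + t *\<^sub>R w) = p + t *\<^sub>R v"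
proof -
  obtain R :: "real^2 \<Rightarrow> real^2" where R: "orthogonal_transformation R" "det (matrix R) = 1" "R w = v"
    using rotation_exists[of w v] assms by auto
  then have lin: "linear R" by (simp add: orthogonal_transformation_linear)
  show thesis
  proof
    show "(\<lambda>y. R y + (p - R q)) \<in> rigid_motions"
      using R lin by (auto simp: rigid_motions_def linear_0 orthogonal_transformation_isometry)
    show "R (q + t *\<^sub>R w) + (p - R q) = p + t *\<^sub>R v" for t
      by (simp add: linear_add[OF lin] linear_cmul[OF lin] R(3))
  qed
qed

theorem theorem4p5:
  fixes n :: nat and x :: "nat \<Rightarrow> real^2"
  assumes "collinear (x ` {1..n})"
    and "commensurable_distances n x"
  shows "weighted_discrete_Pompeiu rigid_motions n x"
  unfolding weighted_discrete_Pompeiu_def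
proof (intro allI impI)
  fix \<alpha> :: "nat \<Rightarrow> complex" and f :: "real^2 \<Rightarrow> complex" and p :: "real^2"
  assume nz: "(\<Sum>i=1..n. \<alpha> i) \<noteq> 0"
    and f: "\<forall>\<phi>\<in>rigid_motions. (\<Sum>j=1..n. \<alpha> j * f (\<phi> (x j))) = 0"
  obtain q w k where w: "w \<noteq> 0" "\<And>i. i \<in> {1..n} \<Longrightarrow> x i = q + of_nat (k i) *\<^sub>R w"
    using commensurable_collinear_imp_arith_progression[OF assms] by metis
  define P where "P = (\<Sum>j\<in>{1..n}. monom (\<alpha> j) (k j))"
  have "poly P 1 \<noteq> 0"
    using nz by (simp add: P_def poly_sum poly_monom)
  moreover have "poly_shift P v f = (\<lambda>_. 0)" if v: "norm v = norm w" for v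
  proof
    fix p
    obtain \<phi> where \<phi>: "\<phi> \<in> rigid_motions" "\<And>t. \<phi> (q + t *\<^sub>R w) = p + t *\<^sub>R v"
      using ex_rigid_motion_mapping_line[OF v] by metis
    have "poly_shift P v f p = (\<Sum>j=1..n. \<alpha> j * f (\<phi> (x j)))"
      by (simp add: P_def poly_shift_sum_monom \<phi>(2) w(2))
    with f \<phi>(1) show "poly_shift P v f p = 0" by simp
  qed
  ultimately have "f = (\<lambda>_. 0)"
    using zero_if_annihilated_by_all_shifts_of_norm[of "norm w" P f] by simp
  then show "f p = 0" by simp
qed

end
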